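(* Let $\mathcal F$ be a reproducing kernel Hilbert space of functions $\mathcal X\to\mathbb R$ with reproducing kernel $\mathcal K$ and norm $\|\cdot\|$. Let $X_1,\dots,X_n\in\mathcal X$ and $T\in\{0,1\}^n$, let $\mathcal T_t=\{i:T_i=t\}$ and $n_t=|\mathcal T_t|\ge1$ for $t=0,1$, and let $K\in\mathbb R^{n\times n}$, $K_{ij}=\mathcal K(X_i,X_j)$, be the Gram matrix. Let $W\in\mathbb R^n$ be weights with $W_i=1/n_1$ for $i\in\mathcal T_1$ and $\sum_{i\in\mathcal T_0}W_i=1$. Put $$\mathfrak E(W;\mathcal F)=\max_{f\in\mathcal F,\ \|f\|\le1}\Bigl(\frac1{n_1}\sum_{i\in\mathcal T_1}f(X_i)-\sum_{i\in\mathcal T_0}W_if(X_i)\Bigr).$$ Then $$\mathfrak E(W;\mathcal F)=\Bigl(\tfrac1{n_1^2}e_{n_1}^TK_{\mathcal T_1,\mathcal T_1}e_{n_1}+W_{\mathcal T_0}^TK_{\mathcal T_0,\mathcal T_0}W_{\mathcal T_0}-\tfrac2{n_1}e_{n_1}^TK_{\mathcal T_1,\mathcal T_0}W_{\mathcal T_0}\Bigr)^{1/2}.$$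
   Context: $e_{m}\in\mathbb R^m$ is the all-ones vector; $K_{A,B}$ denotes the submatrix of $K$ with rows in $A$ and columns in $B$, and $W_{\mathcal T_0}=(W_i)_{i\in\mathcal T_0}$. *)

theory Defs
  imports Complex_Main "Jordan_Normal_Form.DL_Submatrix"
begin

definition ip_norm :: "(('x \<Rightarrow> real) \<Rightarrow> ('x \<Rightarrow> real) \<Rightarrow> real) \<Rightarrow> ('x \<Rightarrow> real) \<Rightarrow> real" where
  "ip_norm ip f = sqrt (ip f f)"

(* The values of ip outside F are irrelevant. *)
locale rkhs =
  fixes F :: "('x \<Rightarrow> real) set"
    and ip :: "('x \<Rightarrow> real) \<Rightarrow> ('x \<Rightarrow> real) \<Rightarrow> real"
    and \<K> :: "'x \<Rightarrow> 'x \<Rightarrow> real"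
  assumes zero_mem: "(\<lambda>x. 0) \<in> F"
    and add_mem: "\<lbrakk>f \<in> F; g \<in> F\<rbrakk> \<Longrightarrow> (\<lambda>x. f x + g x) \<in> F"
    and scale_mem: "f \<in> F \<Longrightarrow> (\<lambda>x. c * f x) \<in> F"
    and ip_add: "\<lbrakk>f \<in> F; g \<in> F; h \<in> F\<rbrakk> \<Longrightarrow> ip (\<lambda>x. f x + g x) h = ip f h + ip g h"
    and ip_scale: "\<lbrakk>f \<in> F; h \<in> F\<rbrakk> \<Longrightarrow> ip (\<lambda>x. c * f x) h = c * ip f h"
    and ip_commute: "\<lbrakk>f \<in> F; g \<in> F\<rbrakk> \<Longrightarrow> ip f g = ip g f"
    and ip_nonneg: "f \<in> F \<Longrightarrow> 0 \<le> ip f f"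
    and ip_definite: "\<lbrakk>f \<in> F; ip f f = 0\<rbrakk> \<Longrightarrow> f = (\<lambda>x. 0)"
    and complete: "\<lbrakk>\<And>k::nat. s k \<in> F;
        \<And>e. e > 0 \<Longrightarrow> \<exists>N. \<forall>k\<ge>N. \<forall>l\<ge>N. ip_norm ip (\<lambda>x. s k x - s l x) < e\<rbrakk>
        \<Longrightarrow> \<exists>f\<in>F. (\<lambda>k. ip_norm ip (\<lambda>x. s k x - f x)) \<longlonglongrightarrow> 0"
    and kernel_mem: "(\<lambda>y. \<K> y x) \<in> F"
    and reproducing: "f \<in> F \<Longrightarrow> f x = ip f (\<lambda>y. \<K> y x)"

(* The index set T_t; indices run over 0, ..., n - 1. *)
definition arm :: "nat vec \<Rightarrow> nat \<Rightarrow> nat set" where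
  "arm T t = {i. i < dim_vec T \<and> T $ i = t}"

definition gram :: "('x \<Rightarrow> 'x \<Rightarrow> real) \<Rightarrow> nat \<Rightarrow> (nat \<Rightarrow> 'x) \<Rightarrow> real mat" where
  "gram \<K> n X = mat n n (\<lambda>(i, j). \<K> (X i) (X j))"

definition ones_vec :: "nat \<Rightarrow> real vec" where
  "ones_vec m = vec m (\<lambda>_. 1)"

(* Vector analogue of submatrix: pick I i is the i-th smallest element of I. *)
definition subvec :: "'a vec \<Rightarrow> nat set \<Rightarrow> 'a vec" where
  "subvec v I = vec (card {i. i < dim_vec v \<and> i \<in> I}) (\<lambda>i. v $ pick I i)"

definition imbalance :: "nat vec \<Rightarrow> (nat \<Rightarrow> 'x) \<Rightarrow> real vec \<Rightarrow> ('x \<Rightarrow> real) \<Rightarrow> real" where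
  "imbalance T X W f =
     1 / real (card (arm T 1)) * (\<Sum>i\<in>arm T 1. f (X i)) - (\<Sum>i\<in>arm T 0. W $ i * f (X i))"

(* GREATEST is unspecified if there is no maximum, so attainment has to be stated
   in addition to the value. *)
definition max_imbalance ::
  "('x \<Rightarrow> real) set \<Rightarrow> (('x \<Rightarrow> real) \<Rightarrow> ('x \<Rightarrow> real) \<Rightarrow> real) \<Rightarrow>
   nat vec \<Rightarrow> (nat \<Rightarrow> 'x) \<Rightarrow> real vec \<Rightarrow> real" where
  "max_imbalance F ip T X W =
     (GREATEST v. v \<in> {imbalance T X W f |f. f \<in> F \<and> ip_norm ip f \<le> 1})"

end

theory Submission
  imports Defs
begin

text \<open>
  By the reproducing property the imbalance is the linear functional
  \<open>f \<mapsto> \<langle>f, g\<rangle>\<close> with representer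
  \<open>g = 1/n\<^sub>1 \<Sum>\<^bsub>i\<in>T\<^sub>1\<^esub> \<K>(\<cdot>, X\<^sub>i) - \<Sum>\<^bsub>i\<in>T\<^sub>0\<^esub> W\<^sub>i \<K>(\<cdot>, X\<^sub>i)\<close>.
  By Cauchy-Schwarz its maximum over the unit ball is \<open>\<parallel>g\<parallel>\<close>, attained at
  \<open>g / \<parallel>g\<parallel>\<close>, and \<open>\<parallel>g\<parallel>\<^sup>2\<close>, the imbalance of \<open>g\<close> itself, is the
  quadratic form in the Gram matrix.
\<close>

context rkhs
begin

lemma ip_add_right:
  "\<lbrakk>f \<in> F; g \<in> F; h \<in> F\<rbrakk> \<Longrightarrow> ip h (\<lambda>x. f x + g x) = ip h f + ip h g"
  by (simp add: ip_commute[of h] ip_add add_mem)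

lemma ip_scale_right: "\<lbrakk>f \<in> F; h \<in> F\<rbrakk> \<Longrightarrow> ip h (\<lambda>x. c * f x) = c * ip h f"
  by (simp add: ip_commute[of h] ip_scale scale_mem)

lemma ip_zero_right: "f \<in> F \<Longrightarrow> ip f (\<lambda>x. 0) = 0"
  using ip_scale_right[of "\<lambda>x. 0" f 0] zero_mem by simp

lemma ip_norm_nonneg: "f \<in> F \<Longrightarrow> 0 \<le> ip_norm ip f"
  by (simp add: ip_norm_def ip_nonneg)

lemma ip_norm_square: "f \<in> F \<Longrightarrow> ip_norm ip f * ip_norm ip f = ip f f"
  by (simp add: ip_norm_def ip_nonneg)

lemma ip_norm_eq_zero: "\<lbrakk>f \<in> F; ip_norm ip f = 0\<rbrakk> \<Longrightarrow> f = (\<lambda>x. 0)"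
  by (simp add: ip_norm_def ip_definite)

text \<open>If one norm vanishes, definiteness makes that function zero and both sides are 0.
  Otherwise the bound follows from nonnegativity of \<open>ip h h\<close> for a suitable combination
  \<open>h\<close> of \<open>f\<close> and \<open>g\<close>.\<close>

lemma Cauchy_Schwarz:
  assumes f: "f \<in> F" and g: "g \<in> F"
  shows "ip f g \<le> ip_norm ip f * ip_norm ip g"
proof (cases "ip_norm ip f = 0 \<or> ip_norm ip g = 0")
  case True
  then have "f = (\<lambda>x. 0) \<or> g = (\<lambda>x. 0)"
    using f g ip_norm_eq_zero by blast
  then have "ip f g = 0"
    using f g ip_commute ip_zero_right zero_mem by metis
  with True show ?thesis by auto
next
  case False
  define s t where "s = ip_norm ip f" and "t = ip_norm ip g"
  have pos: "s > 0" "t > 0"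
    using False ip_norm_nonneg f g by (auto simp: s_def t_def less_le)
  \<comment> \<open>Scaling each function by the norm of the other makes the two square terms of
    \<open>ip h h\<close> equal to (s * t)^2, so that the positive factor 2 * (s * t) splits off and
    can be cancelled.\<close>
  define h where "h = (\<lambda>x. t * f x + (- s) * g x)"
  have mem: "(\<lambda>x. t * f x) \<in> F" "(\<lambda>x. (- s) * g x) \<in> F" "h \<in> F"
    unfolding h_def by (intro scale_mem add_mem f g)+
  have "ip h h = t * ip f h + (- s) * ip g h"
    unfolding h_def using mem f g
    by (subst ip_add) (simp_all only: ip_scale h_def)
  also have "ip f h = t * ip f f + (- s) * ip f g"
    unfolding h_def using mem f g by (simp only: ip_add_right ip_scale_right)
  also have "ip g h = t * ip f g + (- s) * ip g g"
    unfolding h_def using mem f g by (simp only: ip_add_right ip_scale_right ip_commute[of g f])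
  finally have "ip h h = 2 * (s * t) * (s * t - ip f g)"
    by (simp add: ip_norm_square[symmetric] f g s_def[symmetric] t_def[symmetric] algebra_simps)
  then have "0 \<le> 2 * (s * t) * (s * t - ip f g)"
    using ip_nonneg[OF mem(3)] by (simp only:)
  then show ?thesis
    using zero_le_mult_iff[of "2 * (s * t)" "s * t - ip f g"] mult_pos_pos[OF pos]
    by (simp add: s_def t_def)
qed

text \<open>The reproducing property extended linearly to finite kernel combinations. Membership and
  the formula go through one induction, since additivity of \<open>ip\<close> applies only to a
  partial sum known to lie in \<open>F\<close>.\<close>

lemma kernel_sum_mem_ip:
  assumes "finite S"
  shows "(\<lambda>y. \<Sum>i\<in>S. a i * \<K> y (X i)) \<in> F \<and>
    (\<forall>f\<in>F. ip f (\<lambda>y. \<Sum>i\<in>S. a i * \<K> y (X i)) = (\<Sum>i\<in>S. a i * f (X i)))"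
  using assms
proof (induction S rule: finite_induct)
  case empty
  show ?case by (simp add: zero_mem ip_zero_right)
next
  case (insert j S)
  have mem: "(\<lambda>y. a j * \<K> y (X j)) \<in> F"
    by (intro scale_mem kernel_mem)
  have "ip f (\<lambda>y. a j * \<K> y (X j)) = a j * f (X j)" if "f \<in> F" for f
    using that by (simp add: ip_scale_right kernel_mem reproducing[symmetric])
  with insert mem show ?case
    by (simp add: add_mem ip_add_right)
qed

lemma greatest_ip_unit_ball:
  assumes g: "g \<in> F"
  shows "\<exists>f\<in>F. ip_norm ip f \<le> 1 \<and> ip f g = ip_norm ip g"
    and "\<lbrakk>f \<in> F; ip_norm ip f \<le> 1\<rbrakk> \<Longrightarrow> ip f g \<le> ip_norm ip g"
proof -
  show "ip f g \<le> ip_norm ip g" if "f \<in> F" "ip_norm ip f \<le> 1"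
    using Cauchy_Schwarz[OF that(1) g] mult_right_mono[OF that(2) ip_norm_nonneg[OF g]] by simp
  show "\<exists>f\<in>F. ip_norm ip f \<le> 1 \<and> ip f g = ip_norm ip g"
  \<comment> \<open>Normalising \<open>g\<close> is impossible when its norm is 0; then
    \<open>g\<close> is the zero function and attains the value 0 itself.\<close>
  proof (cases "ip_norm ip g = 0")
    case True
    then have "g = (\<lambda>x. 0)" using g ip_norm_eq_zero by blast
    with True g show ?thesis
      by (intro bexI[of _ g]) (simp_all add: ip_zero_right)
  next
    case False
    define c where "c = 1 / ip_norm ip g"
    define f where "f = (\<lambda>x. c * g x)"
    have f: "f \<in> F" unfolding f_def by (intro scale_mem g)
    have fg: "ip f g = c * ip g g"
      unfolding f_def by (rule ip_scale[OF g g])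
    have "ip f f = c * ip f g"
      using ip_scale_right[OF g f, of c] unfolding f_def .
    with fg have "ip f f = c * c * ip g g"
      by simp
    then have "ip f f = 1"
      using False by (simp add: c_def ip_norm_square[OF g, symmetric])
    moreover have "ip f g = ip_norm ip g"
      using False fg by (simp add: c_def ip_norm_square[OF g, symmetric])
    ultimately show ?thesis
      using f by (intro bexI[of _ f]) (simp_all add: ip_norm_def)
  qed
qed

end

lemma finite_arm: "finite (arm T t)"
  by (simp add: arm_def)

text \<open>Injectivity and counting suffice: the image lies in the finite set \<open>I\<close> and
  has as many elements. This turns sums over positions in a submatrix into sums over the original
  indices.\<close>

lemma bij_betw_pick:
  assumes "finite I"
  shows "bij_betw (pick I) {0..<card I} I"
proof -
  have inj: "inj_on (pick I) {0..<card I}"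
    by (rule inj_onI) (metis atLeastLessThan_iff card_pick_le)
  have "pick I ` {0..<card I} \<subseteq> I"
    using pick_in_set_le by auto
  moreover have "card (pick I ` {0..<card I}) = card I"
    using card_image[OF inj] by simp
  ultimately have "pick I ` {0..<card I} = I"
    using assms card_subset_eq by blast
  with inj show ?thesis by (simp add: bij_betw_def)
qed

text \<open>Both sums are reindexed along \<open>pick\<close>, the inner one first. Entries of the
  form \<open>a (pick I k)\<close> cover a restricted weight vector and, with constant
  \<open>a\<close>, an all-ones vector.\<close>

lemma scalar_prod_submatrix:
  fixes A :: "real mat"
  assumes A: "A \<in> carrier_mat m n" and I: "I \<subseteq> {..<m}" and J: "J \<subseteq> {..<n}"
    and u: "u = vec (card I) (\<lambda>k. a (pick I k))"
    and v: "v = vec (card J) (\<lambda>k. b (pick J k))"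
  shows "u \<bullet> (submatrix A I J *\<^sub>v v) = (\<Sum>i\<in>I. \<Sum>j\<in>J. a i * A $$ (i, j) * b j)"
proof -
  have dims: "{i. i < dim_row A \<and> i \<in> I} = I" "{j. j < dim_col A \<and> j \<in> J} = J"
    using A I J by auto
  have fin: "finite I" "finite J"
    using I J finite_subset by blast+
  have "u \<bullet> (submatrix A I J *\<^sub>v v) = (\<Sum>k = 0..<card I. \<Sum>l = 0..<card J.
      a (pick I k) * A $$ (pick I k, pick J l) * b (pick J l))"
    unfolding u v
    by (simp add: scalar_prod_def mult_mat_vec_def submatrix_def dims sum_distrib_left mult.assoc)
  also have "\<dots> = (\<Sum>k = 0..<card I. \<Sum>j\<in>J. a (pick I k) * A $$ (pick I k, j) * b j)"
    by (intro sum.cong refl sum.reindex_bij_betw bij_betw_pick fin)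
  also have "\<dots> = (\<Sum>i\<in>I. \<Sum>j\<in>J. a i * A $$ (i, j) * b j)"
    by (rule sum.reindex_bij_betw[OF bij_betw_pick[OF fin(1)]])
  finally show ?thesis .
qed

theorem theorem6:
  fixes F :: "('x \<Rightarrow> real) set"
    and ip :: "('x \<Rightarrow> real) \<Rightarrow> ('x \<Rightarrow> real) \<Rightarrow> real"
    and \<K> :: "'x \<Rightarrow> 'x \<Rightarrow> real"
    and n n\<^sub>0 n\<^sub>1 :: nat
    and X :: "nat \<Rightarrow> 'x"
    and T :: "nat vec"
    and W :: "real vec"
    and K :: "real mat"
  assumes "rkhs F ip \<K>"
    and "T \<in> carrier_vec n" and "\<forall>i<n. T $ i \<in> {0, 1}"
    and "n\<^sub>0 = card (arm T 0)" and "n\<^sub>1 = card (arm T 1)"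
    and "n\<^sub>0 \<ge> 1" and "n\<^sub>1 \<ge> 1"
    and "K = gram \<K> n X"
    and "W \<in> carrier_vec n"
    and "\<forall>i\<in>arm T 1. W $ i = 1 / real n\<^sub>1"
    and "(\<Sum>i\<in>arm T 0. W $ i) = 1"
  shows "(\<exists>f\<in>F. ip_norm ip f \<le> 1 \<and> imbalance T X W f = max_imbalance F ip T X W)
    \<and> (\<forall>f\<in>F. ip_norm ip f \<le> 1 \<longrightarrow> imbalance T X W f \<le> max_imbalance F ip T X W)
    \<and> max_imbalance F ip T X W = sqrt (
        1 / (real n\<^sub>1)\<^sup>2 * (ones_vec n\<^sub>1 \<bullet> (submatrix K (arm T 1) (arm T 1) *\<^sub>v ones_vec n\<^sub>1))
        + subvec W (arm T 0) \<bullet> (submatrix K (arm T 0) (arm T 0) *\<^sub>v subvec W (arm T 0))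
        - 2 / real n\<^sub>1 * (ones_vec n\<^sub>1 \<bullet> (submatrix K (arm T 1) (arm T 0) *\<^sub>v subvec W (arm T 0))))"
proof -
  interpret rkhs F ip \<K> by fact
  define A\<^sub>0 A\<^sub>1 where "A\<^sub>0 = arm T 0" and "A\<^sub>1 = arm T 1"
  have fin: "finite A\<^sub>0" "finite A\<^sub>1"
    by (simp_all add: A\<^sub>0_def A\<^sub>1_def finite_arm)
  have sub: "A\<^sub>0 \<subseteq> {..<n}" "A\<^sub>1 \<subseteq> {..<n}"
    using assms(2) by (auto simp: A\<^sub>0_def A\<^sub>1_def arm_def)
  define c where "c = 1 / real n\<^sub>1"
  define g\<^sub>1 where "g\<^sub>1 = (\<lambda>y. \<Sum>i\<in>A\<^sub>1. c * \<K> y (X i))"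
  define g\<^sub>0 where "g\<^sub>0 = (\<lambda>y. \<Sum>i\<in>A\<^sub>0. W $ i * \<K> y (X i))"
  \<comment> \<open>The difference is written with the scalar -1 so that closure and linearity for
    sums and multiples apply directly.\<close>
  define g where "g = (\<lambda>y. g\<^sub>1 y + (- 1) * g\<^sub>0 y)"
  have g\<^sub>1: "g\<^sub>1 \<in> F" "\<And>f. f \<in> F \<Longrightarrow> ip f g\<^sub>1 = (\<Sum>i\<in>A\<^sub>1. c * f (X i))"
    using kernel_sum_mem_ip[OF fin(2), of "\<lambda>_. c" X] by (auto simp: g\<^sub>1_def)
  have g\<^sub>0: "g\<^sub>0 \<in> F" "\<And>f. f \<in> F \<Longrightarrow> ip f g\<^sub>0 = (\<Sum>i\<in>A\<^sub>0. W $ i * f (X i))"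
    using kernel_sum_mem_ip[OF fin(1), of "\<lambda>i. W $ i" X] by (auto simp: g\<^sub>0_def)
  have g: "g \<in> F"
    unfolding g_def by (intro add_mem scale_mem g\<^sub>0 g\<^sub>1)
  have ip_g: "ip f g = ip f g\<^sub>1 - ip f g\<^sub>0" if "f \<in> F" for f
    using ip_add_right[OF g\<^sub>1(1) scale_mem[OF g\<^sub>0(1), of "- 1"] that]
      ip_scale_right[OF g\<^sub>0(1) that, of "- 1"] by (simp add: g_def)
  have imb: "imbalance T X W f = ip f g" if "f \<in> F" for f
    using that
    by (simp add: ip_g g\<^sub>0 g\<^sub>1 imbalance_def c_def A\<^sub>0_def A\<^sub>1_def assms(5) sum_distrib_left)

  obtain f where f: "f \<in> F" "ip_norm ip f \<le> 1" "ip f g = ip_norm ip g"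
    using greatest_ip_unit_ball(1)[OF g] by blast
  \<comment> \<open>\<open>GREATEST\<close> is determined only once a value is shown to be both
    attained and an upper bound; \<open>f\<close> supplies attainment, Cauchy-Schwarz the
    bound.\<close>
  have max: "max_imbalance F ip T X W = ip_norm ip g"
    unfolding max_imbalance_def
  proof (rule Greatest_equality)
    show "ip_norm ip g \<in> {imbalance T X W f |f. f \<in> F \<and> ip_norm ip f \<le> 1}"
      using f imb by force
    show "v \<le> ip_norm ip g" if "v \<in> {imbalance T X W f |f. f \<in> F \<and> ip_norm ip f \<le> 1}" for v
      using that imb greatest_ip_unit_ball(2)[OF g] by auto
  qed

  have K: "K \<in> carrier_mat n n" "\<And>i j. \<lbrakk>i < n; j < n\<rbrakk> \<Longrightarrow> K $$ (i, j) = \<K> (X i) (X j)"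
    by (simp_all add: assms(8) gram_def)
  have ones: "ones_vec n\<^sub>1 = vec (card A\<^sub>1) (\<lambda>k. (\<lambda>_. 1) (pick A\<^sub>1 k))"
    by (simp add: ones_vec_def A\<^sub>1_def assms(5))
  \<comment> \<open>All indices in \<open>A\<^sub>0\<close> are below n, so the length of
    \<open>subvec W A\<^sub>0\<close> is the full cardinality of \<open>A\<^sub>0\<close>.\<close>
  have "{i. i < dim_vec W \<and> i \<in> A\<^sub>0} = A\<^sub>0"
    using sub assms(9) by auto
  then have W: "subvec W A\<^sub>0 = vec (card A\<^sub>0) (\<lambda>k. W $ pick A\<^sub>0 k)"
    by (simp add: subvec_def)
  \<comment> \<open>The inner sum on the right is a kernel combination evaluated at
    \<open>X i\<close>, the form in which \<open>g\<^sub>0\<close> and \<open>g\<^sub>1\<close>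
    enter the inner products.\<close>
  have gram_sum: "(\<Sum>i\<in>I. \<Sum>j\<in>J. a i * K $$ (i, j) * b j)
      = (\<Sum>i\<in>I. a i * (\<Sum>j\<in>J. b j * \<K> (X i) (X j)))"
    if "I \<subseteq> {..<n}" "J \<subseteq> {..<n}" for I J a b
    unfolding sum_distrib_left using that
    by (intro sum.cong refl) (auto simp: K(2) subset_iff)
  have c_sum: "g\<^sub>1 y = c * (\<Sum>i\<in>A\<^sub>1. \<K> y (X i))" for y
    by (simp add: g\<^sub>1_def sum_distrib_left)
  have E11: "ip g\<^sub>1 g\<^sub>1 = c\<^sup>2 * (ones_vec n\<^sub>1 \<bullet> (submatrix K A\<^sub>1 A\<^sub>1 *\<^sub>v ones_vec n\<^sub>1))"
    unfolding scalar_prod_submatrix[OF K(1) sub(2) sub(2) ones ones] gram_sum[OF sub(2) sub(2)]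
    by (simp add: g\<^sub>1(2)[OF g\<^sub>1(1)] c_sum power2_eq_square sum_distrib_left mult.assoc)
  have E00: "ip g\<^sub>0 g\<^sub>0 = subvec W A\<^sub>0 \<bullet> (submatrix K A\<^sub>0 A\<^sub>0 *\<^sub>v subvec W A\<^sub>0)"
    unfolding scalar_prod_submatrix[OF K(1) sub(1) sub(1) W W] gram_sum[OF sub(1) sub(1)]
    by (simp add: g\<^sub>0(2)[OF g\<^sub>0(1)]) (simp add: g\<^sub>0_def)
  \<comment> \<open>Pairing with \<open>g\<^sub>1\<close> evaluates \<open>g\<^sub>0\<close> at the
    points of \<open>A\<^sub>1\<close>. In this order rows come from \<open>A\<^sub>1\<close> and
    columns from \<open>A\<^sub>0\<close>, as in the claimed cross term.\<close>
  have E10: "ip g\<^sub>0 g\<^sub>1 = c * (ones_vec n\<^sub>1 \<bullet> (submatrix K A\<^sub>1 A\<^sub>0 *\<^sub>v subvec W A\<^sub>0))"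
    unfolding scalar_prod_submatrix[OF K(1) sub(2) sub(1) ones W] gram_sum[OF sub(2) sub(1)]
    by (simp add: g\<^sub>1(2)[OF g\<^sub>0(1)] sum_distrib_left) (simp add: g\<^sub>0_def sum_distrib_left)
  \<comment> \<open>\<open>ip_g\<close> splits only the second argument, so symmetry moves
    \<open>g\<close> back there before the second expansion.\<close>
  have "ip g g = ip g\<^sub>1 g - ip g\<^sub>0 g"
    using ip_g[OF g] g g\<^sub>0(1) g\<^sub>1(1) by (simp add: ip_commute)
  also have "\<dots> = ip g\<^sub>1 g\<^sub>1 + ip g\<^sub>0 g\<^sub>0 - 2 * ip g\<^sub>0 g\<^sub>1"
    using ip_commute[OF g\<^sub>0(1) g\<^sub>1(1)] by (simp add: ip_g g\<^sub>0(1) g\<^sub>1(1))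
  finally have gg: "ip g g = c\<^sup>2 * (ones_vec n\<^sub>1 \<bullet> (submatrix K A\<^sub>1 A\<^sub>1 *\<^sub>v ones_vec n\<^sub>1))
      + subvec W A\<^sub>0 \<bullet> (submatrix K A\<^sub>0 A\<^sub>0 *\<^sub>v subvec W A\<^sub>0)
      - 2 * c * (ones_vec n\<^sub>1 \<bullet> (submatrix K A\<^sub>1 A\<^sub>0 *\<^sub>v subvec W A\<^sub>0))"
    by (simp only: E11 E00 E10 mult.assoc)
  show ?thesis
  proof (intro conjI ballI impI)
    show "\<exists>f\<in>F. ip_norm ip f \<le> 1 \<and> imbalance T X W f = max_imbalance F ip T X W"
      using f imb max by auto
    show "imbalance T X W f \<le> max_imbalance F ip T X W" if "f \<in> F" "ip_norm ip f \<le> 1" for f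
      using that imb max greatest_ip_unit_ball(2)[OF g] by simp
  qed (simp add: max ip_norm_def gg c_def A\<^sub>0_def A\<^sub>1_def power_divide)
qed

end
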